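(* Let $F$ be a distribution on $\mathbb{R}^d$, $d\ge2$, with a Lebesgue density, and let $X_1,X_2,\dots$ be i.i.d. from $F$. For $(x,u)\in\mathbb{R}^d\times S^{d-1}$ set $\sigma^2_{x,u}(s)=d_{x,u}(s)(1-d_{x,u}(s))$, $s\in\mathbb{R}$. (i) For $(x,u,s)\in\mathbb{R}^d\times S^{d-1}\times\mathbb{R}$ with $\Delta_{x,u}(s)\ne0$, $$\sqrt n\,\big(\widehat d_{x,u}(s)-d_{x,u}(s)\big)\to\mathcal{N}(0,\sigma^2_{x,u}(s))\quad\text{in distribution as }n\to\infty.$$ (ii) For $(x,u,s)\in\mathbb{R}^d\times S^{d-1}\times\mathbb{R}$ with $\Delta_{x,u}(s)=0$, $$\sqrt n\,\big(\widehat d_{x,u}(s)-d_{x,u}(s)\big)\to\min(N_1,N_2)\quad\text{in distribution as }n\to\infty,$$ where $N_1,N_2$ are jointly normal with mean zero, variance $\sigma^2_{x,u}(s)$ each, and covariance $\mathrm{Cov}(N_1,N_2)=-d_{x,u}(s)^2$.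
   Context: Fix an opening angle $\alpha\in[0,\pi)$. For $x\in\mathbb{R}^d$, $u\in S^{d-1}$ (unit sphere) and $s\in\mathbb{R}$, $C_{x,u}(s)$ is the closed (infinite, solid) right spherical cone with opening angle $\alpha$ (angle $\alpha/2$ between axis and boundary), axis of symmetry $\{x+tu: t\in\mathbb{R}\}$ and tip $y=x+su$, oriented so that it contains $x$: for $s\ge 0$ it is $\{z:\langle z-y,-u\rangle\ge\cos(\alpha/2)\|z-y\|\}$, and for $s<0$ it is $\{z:\langle z-y,u\rangle\ge\cos(\alpha/2)\|z-y\|\}$. The hyperplane $\{z:\langle z-x,u\rangle=0\}$ splits $C_{x,u}(s)$ into two closed sets: for $s\ge0$, $A_{x,u}(s)=C_{x,u}(s)\cap\{z:\langle z-x,u\rangle\ge 0\}$ (the part on the side of the tip) and $B_{x,u}(s)=C_{x,u}(s)\cap\{z:\langle z-x,u\rangle\le 0\}$; for $s<0$ the two half-spaces are interchanged. $d_{x,u}(s)=\min(F(A_{x,u}(s)),F(B_{x,u}(s)))$ and, with $F_n$ the empirical distribution of $X_1,\dots,X_n$, $\widehat d_{x,u}(s)=\min(F_n(A_{x,u}(s)),F_n(B_{x,u}(s)))$. $\Delta_{x,u}(s)=|F(A_{x,u}(s))-F(B_{x,u}(s))|$. *)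

theory Defs
  imports "HOL-Probability.Probability"
begin

definition cone_tip :: "real^'d \<Rightarrow> real^'d \<Rightarrow> real \<Rightarrow> real^'d" where
  "cone_tip x u s = x + s *\<^sub>R u"

text \<open>The axis is reversed with the sign of \<open>s\<close>, so that the cone contains \<open>x\<close>.\<close>

definition cone_at :: "real \<Rightarrow> real^'d \<Rightarrow> real^'d \<Rightarrow> real \<Rightarrow> (real^'d) set" where
  "cone_at \<alpha> x u s =
     (if s \<ge> 0
      then {z. (z - cone_tip x u s) \<bullet> (- u) \<ge> cos (\<alpha> / 2) * norm (z - cone_tip x u s)}
      else {z. (z - cone_tip x u s) \<bullet> u \<ge> cos (\<alpha> / 2) * norm (z - cone_tip x u s)})"

definition cone_A :: "real \<Rightarrow> real^'d \<Rightarrow> real^'d \<Rightarrow> real \<Rightarrow> (real^'d) set" where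
  "cone_A \<alpha> x u s =
     cone_at \<alpha> x u s \<inter> (if s \<ge> 0 then {z. (z - x) \<bullet> u \<ge> 0} else {z. (z - x) \<bullet> u \<le> 0})"

definition cone_B :: "real \<Rightarrow> real^'d \<Rightarrow> real^'d \<Rightarrow> real \<Rightarrow> (real^'d) set" where
  "cone_B \<alpha> x u s =
     cone_at \<alpha> x u s \<inter> (if s \<ge> 0 then {z. (z - x) \<bullet> u \<le> 0} else {z. (z - x) \<bullet> u \<ge> 0})"

text \<open>Taking the measure as an argument, this is \<open>d\<close> for the distribution \<open>F\<close> and its
  empirical version for the empirical distribution.\<close>

definition cone_d :: "real \<Rightarrow> (real^'d) measure \<Rightarrow> real^'d \<Rightarrow> real^'d \<Rightarrow> real \<Rightarrow> real" where
  "cone_d \<alpha> F x u s = min (measure F (cone_A \<alpha> x u s)) (measure F (cone_B \<alpha> x u s))"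

definition cone_Delta :: "real \<Rightarrow> (real^'d) measure \<Rightarrow> real^'d \<Rightarrow> real^'d \<Rightarrow> real \<Rightarrow> real" where
  "cone_Delta \<alpha> F x u s = \<bar>measure F (cone_A \<alpha> x u s) - measure F (cone_B \<alpha> x u s)\<bar>"

definition cone_sigma2 :: "real \<Rightarrow> (real^'d) measure \<Rightarrow> real^'d \<Rightarrow> real^'d \<Rightarrow> real \<Rightarrow> real" where
  "cone_sigma2 \<alpha> F x u s = cone_d \<alpha> F x u s * (1 - cone_d \<alpha> F x u s)"

text \<open>Mass \<open>1/n\<close> at each of the sample points \<open>y 0, \<dots>, y (n - 1)\<close>, counted with multiplicity;
  the null measure for \<open>n = 0\<close>.\<close>

definition empirical_distribution ::
    "nat \<Rightarrow> (nat \<Rightarrow> 'a::topological_space) \<Rightarrow> 'a measure" where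
  "empirical_distribution n y = distr (uniform_count_measure {..<n}) borel y"

text \<open>The second argument is the variance. Variance \<open>0\<close> gives the point mass at the mean;
  this degenerate case does occur, for instance when \<open>F\<close> gives the cone measure zero.\<close>

definition normal_distribution :: "real \<Rightarrow> real \<Rightarrow> real measure" where
  "normal_distribution \<mu> v =
     (if v = 0 then return borel \<mu>
      else density lborel (\<lambda>t. ennreal (normal_density \<mu> (sqrt v) t)))"

text \<open>Joint normality in the sense that every linear combination is normal, with singular
  covariance matrices allowed.\<close>

definition jointly_normal :: "'a measure \<Rightarrow> ('a \<Rightarrow> real) \<Rightarrow> ('a \<Rightarrow> real) \<Rightarrow> bool" where
  "jointly_normal P Y Z \<longleftrightarrow>
     prob_space P \<and> Y \<in> borel_measurable P \<and> Z \<in> borel_measurable P \<and>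
     (\<forall>a b. \<exists>\<mu> v. v \<ge> 0 \<and> distr P borel (\<lambda>\<omega>. a * Y \<omega> + b * Z \<omega>) = normal_distribution \<mu> v)"

definition covariance :: "'a measure \<Rightarrow> ('a \<Rightarrow> real) \<Rightarrow> ('a \<Rightarrow> real) \<Rightarrow> real" where
  "covariance P Y Z =
     (\<integral>\<omega>. (Y \<omega> - (\<integral>\<omega>. Y \<omega> \<partial>P)) * (Z \<omega> - (\<integral>\<omega>. Z \<omega> \<partial>P)) \<partial>P)"

definition centred_normal_pair ::
    "'a measure \<Rightarrow> ('a \<Rightarrow> real) \<Rightarrow> ('a \<Rightarrow> real) \<Rightarrow> real \<Rightarrow> real \<Rightarrow> bool" where
  "centred_normal_pair P Y Z v c \<longleftrightarrow>
     jointly_normal P Y Z \<and>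
     (\<integral>\<omega>. Y \<omega> \<partial>P) = 0 \<and> (\<integral>\<omega>. Z \<omega> \<partial>P) = 0 \<and>
     prob_space.variance P Y = v \<and> prob_space.variance P Z = v \<and>
     covariance P Y Z = c"

end

theory Submission
  imports Defs
begin

text \<open>
  Fix the two pieces \<open>A\<close> and \<open>B\<close> of the cone and write \<open>U\<^sub>n\<close>, \<open>V\<^sub>n\<close> for the centred and
  \<open>sqrt n\<close>-scaled empirical masses of \<open>A\<close> and \<open>B\<close>. Every combination \<open>a U\<^sub>n + b V\<^sub>n\<close> is a
  normalised sum of i.i.d. bounded variables, so the one-dimensional central limit theorem gives its
  limit. As \<open>A\<close> and \<open>B\<close> overlap only in a hyperplane, which is null for a distribution with a
  density, the covariance of the two indicators is minus the product of the two masses.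

  If the masses differ, say \<open>F A < F B\<close>, then the scaled deviation of the minimum from \<open>F A\<close> is
  \<open>min U\<^sub>n (V\<^sub>n + sqrt n (F B - F A))\<close>. The second argument escapes to infinity, so only \<open>U\<^sub>n\<close>
  survives in the limit (\<open>weak_conv_m_min_shifted\<close>).

  If the masses agree, the deviation is \<open>min U\<^sub>n V\<^sub>n\<close>, and one needs the joint limit of
  \<open>(U\<^sub>n, V\<^sub>n)\<close>, that is, a two-dimensional continuity theorem. Only test functions
  \<open>g(U\<^sub>n) h(V\<^sub>n)\<close> of product form are needed, because \<open>min U V > t\<close> means that both \<open>U > t\<close> and
  \<open>V > t\<close>. For these, two applications of the one-dimensional theorem of Levy suffice
  (\<open>joint_levy_continuity\<close>): reweighting the probability measure by a bounded positive function of
  \<open>U\<^sub>n\<close> and letting \<open>V\<^sub>n\<close> vary passes from exponentials in both variables to \<open>h(V\<^sub>n)\<close> times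
  an exponential in \<open>U\<^sub>n\<close>, and reweighting by \<open>h(V\<^sub>n)\<close> removes the remaining exponential.
  The same argument shows that the limit depends on the limiting pair only through its variance and
  covariance, which is why every such pair may be used.
\<close>

section \<open>Normal distributions and centred normal pairs\<close>

lemma real_distribution_std_normal_affine:
  "real_distribution (distr std_normal_distribution borel (\<lambda>x. \<mu> + \<sigma> * x))"
proof -
  interpret real_distribution std_normal_distribution by (rule real_dist_normal_dist)
  show ?thesis by simp
qed

text \<open>The affine representation holds for variance \<open>0\<close> as well. Everything below that
  concerns normal laws is read off from it, so that the degenerate case needs no separate
  treatment.\<close>

lemma normal_distribution_eq_distr:
  assumes "v \<ge> 0"
  shows "normal_distribution \<mu> v = distr std_normal_distribution borel (\<lambda>x. \<mu> + sqrt v * x)"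
proof (cases "v = 0")
  case True
  interpret real_distribution std_normal_distribution by (rule real_dist_normal_dist)
  show ?thesis
    using True by (simp add: normal_distribution_def distr_const)
next
  case False
  interpret real_distribution std_normal_distribution by (rule real_dist_normal_dist)
  have "distributed std_normal_distribution lborel (\<lambda>x. x) std_normal_density"
    by (auto simp: distributed_def intro!: measure_eqI[symmetric] simp: emeasure_distr)
  then have "distributed std_normal_distribution lborel (\<lambda>x. \<mu> + sqrt v * x)
      (normal_density (\<mu> + sqrt v * 0) (\<bar>sqrt v\<bar> * 1))"
    using False assms by (intro normal_density_affine) auto
  then have "distr std_normal_distribution lborel (\<lambda>x. \<mu> + sqrt v * x)
      = density lborel (normal_density \<mu> (sqrt v))"
    using assms by (simp add: distributed_distr_eq_density)
  moreover have "distr std_normal_distribution lborel (\<lambda>x. \<mu> + sqrt v * x)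
      = distr std_normal_distribution borel (\<lambda>x. \<mu> + sqrt v * x)"
    by (intro distr_cong) auto
  ultimately show ?thesis
    using False by (simp add: normal_distribution_def)
qed

lemma real_distribution_normal_distribution:
  "v \<ge> 0 \<Longrightarrow> real_distribution (normal_distribution \<mu> v)"
  by (simp add: normal_distribution_eq_distr real_distribution_std_normal_affine)

lemma char_normal_distribution:
  assumes "v \<ge> 0"
  shows "char (normal_distribution 0 v) t = exp (- (v * t\<^sup>2) / 2)"
proof -
  have "char (normal_distribution 0 v) t = char std_normal_distribution (t * sqrt v)"
    unfolding char_def normal_distribution_eq_distr[OF assms]
    by (subst integral_distr) (auto simp: mult_ac)
  also have "\<dots> = exp (- (v * t\<^sup>2) / 2)"
    using assms by (simp add: char_std_normal_distribution power_mult_distrib mult_ac flip: of_real_exp)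
  finally show ?thesis .
qed

lemma normal_distribution_moments:
  assumes Y: "Y \<in> borel_measurable P"
    and D: "distr P borel Y = normal_distribution \<mu> v" and v: "v \<ge> 0"
  shows "integrable P Y" and "integrable P (\<lambda>\<omega>. (Y \<omega>)\<^sup>2)"
    and "(\<integral>\<omega>. Y \<omega> \<partial>P) = \<mu>" and "(\<integral>\<omega>. (Y \<omega> - \<mu>)\<^sup>2 \<partial>P) = v"
proof -
  define S where "S = std_normal_distribution"
  interpret S: real_distribution S unfolding S_def by (rule real_dist_normal_dist)
  let ?q = "\<lambda>x. \<mu> + sqrt v * x"
  have tr: "integrable P (\<lambda>\<omega>. f (Y \<omega>)) \<longleftrightarrow> integrable S (\<lambda>x. f (?q x))"
      "(\<integral>\<omega>. f (Y \<omega>) \<partial>P) = (\<integral>x. f (?q x) \<partial>S)"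
    if [measurable]: "f \<in> borel_measurable borel" for f :: "real \<Rightarrow> real"
  proof -
    have eq: "distr P borel Y = distr S borel ?q"
      using D v by (simp only: normal_distribution_eq_distr S_def)
    have "integrable P (\<lambda>\<omega>. f (Y \<omega>)) \<longleftrightarrow> integrable (distr P borel Y) f"
      using Y by (intro integrable_distr_eq[symmetric]) auto
    also have "\<dots> \<longleftrightarrow> integrable S (\<lambda>x. f (?q x))"
      unfolding eq by (intro integrable_distr_eq) auto
    finally show "integrable P (\<lambda>\<omega>. f (Y \<omega>)) \<longleftrightarrow> integrable S (\<lambda>x. f (?q x))" .
    have "(\<integral>\<omega>. f (Y \<omega>) \<partial>P) = integral\<^sup>L (distr P borel Y) f"
      using Y by (intro integral_distr[symmetric]) auto
    also have "\<dots> = (\<integral>x. f (?q x) \<partial>S)"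
      unfolding eq by (intro integral_distr) auto
    finally show "(\<integral>\<omega>. f (Y \<omega>) \<partial>P) = (\<integral>x. f (?q x) \<partial>S)" .
  qed
  have m1: "integrable S (\<lambda>x. x)" "(\<integral>x. x \<partial>S) = 0"
    using integrable_std_normal_distribution_moment[of 1]
      integral_std_normal_distribution_moment_odd[of 1] by (simp_all add: S_def)
  have m2: "integrable S (\<lambda>x. x\<^sup>2)" "(\<integral>x. x\<^sup>2 \<partial>S) = 1"
    using integrable_std_normal_distribution_moment[of 2]
      std_normal_distribution_even_moments[of 1] by (simp_all add: S_def)
  have sq: "(\<mu> + sqrt v * x)\<^sup>2 = \<mu>\<^sup>2 + 2 * \<mu> * sqrt v * x + (sqrt v)\<^sup>2 * x\<^sup>2" for x
    by (simp add: power2_eq_square algebra_simps)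
  have "integrable S ?q" "integrable S (\<lambda>x. (?q x)\<^sup>2)"
    unfolding sq using m1 m2 by simp_all
  then show "integrable P Y" "integrable P (\<lambda>\<omega>. (Y \<omega>)\<^sup>2)"
    using tr(1)[of "\<lambda>x. x"] tr(1)[of "\<lambda>x. x\<^sup>2"] by simp_all
  have "(\<integral>x. ?q x \<partial>S) = \<mu>"
    using m1 S.prob_space by simp
  then show "(\<integral>\<omega>. Y \<omega> \<partial>P) = \<mu>"
    using tr(2)[of "\<lambda>x. x"] by simp
  have "(\<integral>x. (?q x - \<mu>)\<^sup>2 \<partial>S) = v"
    using m2 v by (simp add: power_mult_distrib)
  then show "(\<integral>\<omega>. (Y \<omega> - \<mu>)\<^sup>2 \<partial>P) = v"
    using tr(2)[of "\<lambda>x. (x - \<mu>)\<^sup>2"] by simp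
qed

text \<open>The definition of joint normality leaves the parameters of each combination
  open; they are determined by the first two moments. The product of the two variables is
  integrable because their sum is again normal, hence square integrable.\<close>

lemma centred_normal_pair_combination:
  assumes "centred_normal_pair P Y Z v c"
  shows "0 \<le> (a\<^sup>2 + b\<^sup>2) * v + 2 * a * b * c"
    and "distr P borel (\<lambda>\<omega>. a * Y \<omega> + b * Z \<omega>)
      = normal_distribution 0 ((a\<^sup>2 + b\<^sup>2) * v + 2 * a * b * c)"
proof -
  have J: "jointly_normal P Y Z" and mean: "(\<integral>\<omega>. Y \<omega> \<partial>P) = 0" "(\<integral>\<omega>. Z \<omega> \<partial>P) = 0"
    and var: "(\<integral>\<omega>. (Y \<omega>)\<^sup>2 \<partial>P) = v" "(\<integral>\<omega>. (Z \<omega>)\<^sup>2 \<partial>P) = v" "(\<integral>\<omega>. Y \<omega> * Z \<omega> \<partial>P) = c"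
    using assms by (auto simp: centred_normal_pair_def covariance_def)
  have [measurable]: "Y \<in> borel_measurable P" "Z \<in> borel_measurable P"
    and comb: "\<exists>\<mu> w. w \<ge> 0 \<and> distr P borel (\<lambda>\<omega>. a * Y \<omega> + b * Z \<omega>) = normal_distribution \<mu> w" for a b
    using J by (auto simp: jointly_normal_def)
  have intY: "integrable P Y" "integrable P (\<lambda>\<omega>. (Y \<omega>)\<^sup>2)"
    using comb[of 1 0] normal_distribution_moments(1,2)[of Y P] by (simp, blast)+
  have intZ: "integrable P Z" "integrable P (\<lambda>\<omega>. (Z \<omega>)\<^sup>2)"
    using comb[of 0 1] normal_distribution_moments(1,2)[of Z P] by (simp, blast)+
  have intYZ: "integrable P (\<lambda>\<omega>. Y \<omega> * Z \<omega>)"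
  proof -
    obtain \<mu> w where "w \<ge> 0" "distr P borel (\<lambda>\<omega>. 1 * Y \<omega> + 1 * Z \<omega>) = normal_distribution \<mu> w"
      using comb by blast
    then have "integrable P (\<lambda>\<omega>. (Y \<omega> + Z \<omega>)\<^sup>2)"
      by (intro normal_distribution_moments(2)) auto
    then have "integrable P (\<lambda>\<omega>. ((Y \<omega> + Z \<omega>)\<^sup>2 - (Y \<omega>)\<^sup>2 - (Z \<omega>)\<^sup>2) / 2)"
      using intY intZ by auto
    then show ?thesis by (simp add: power2_sum)
  qed
  obtain \<mu> w where w: "w \<ge> 0"
    and D: "distr P borel (\<lambda>\<omega>. a * Y \<omega> + b * Z \<omega>) = normal_distribution \<mu> w"
    using comb by blast
  have "\<mu> = (\<integral>\<omega>. a * Y \<omega> + b * Z \<omega> \<partial>P)"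
    using normal_distribution_moments(3)[OF _ D w] by simp
  also have "\<dots> = 0"
    using intY intZ mean by simp
  finally have \<mu>: "\<mu> = 0" .
  have "w = (\<integral>\<omega>. (a * Y \<omega> + b * Z \<omega>)\<^sup>2 \<partial>P)"
    using normal_distribution_moments(4)[OF _ D w] \<mu> by simp
  also have "\<dots> = (\<integral>\<omega>. a\<^sup>2 * (Y \<omega>)\<^sup>2 + b\<^sup>2 * (Z \<omega>)\<^sup>2 + 2 * a * b * (Y \<omega> * Z \<omega>) \<partial>P)"
    by (intro Bochner_Integration.integral_cong) (auto simp: power2_eq_square algebra_simps)
  also have "\<dots> = (a\<^sup>2 + b\<^sup>2) * v + 2 * a * b * c"
    using intY intZ intYZ var by (simp add: distrib_right)
  finally have "w = (a\<^sup>2 + b\<^sup>2) * v + 2 * a * b * c" .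
  with w D \<mu> show "0 \<le> (a\<^sup>2 + b\<^sup>2) * v + 2 * a * b * c"
    and "distr P borel (\<lambda>\<omega>. a * Y \<omega> + b * Z \<omega>)
      = normal_distribution 0 ((a\<^sup>2 + b\<^sup>2) * v + 2 * a * b * c)" by simp_all
qed

text \<open>With equal variances, sum and difference are uncorrelated, so the pair can be
  written as \<open>p G + q H\<close> and \<open>p G - q H\<close> for independent standard normal \<open>G\<close>, \<open>H\<close> with
  \<open>p\<^sup>2 + q\<^sup>2 = v\<close> and \<open>p\<^sup>2 - q\<^sup>2 = c\<close>. That the combinations are normal follows by comparing
  characteristic functions, which covers vanishing \<open>p\<close> or \<open>q\<close>.\<close>

lemma centred_normal_pair_exists:
  assumes "0 \<le> v + c" "0 \<le> v - c"
  shows "\<exists>(P :: (real \<times> real) measure) N1 N2. centred_normal_pair P N1 N2 v c"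
proof -
  define S where "S = std_normal_distribution"
  interpret S: real_distribution S unfolding S_def by (rule real_dist_normal_dist)
  define R where "R = S \<Otimes>\<^sub>M S"
  interpret pair_prob_space S S by intro_locales
  have R: "prob_space R" unfolding R_def by (rule P.prob_space_axioms)
  interpret R: prob_space R by fact
  define p q where "p = sqrt ((v + c) / 2)" and "q = sqrt ((v - c) / 2)"
  have pq: "p\<^sup>2 = (v + c) / 2" "q\<^sup>2 = (v - c) / 2"
    using assms by (auto simp: p_def q_def)
  define Y Z where "Y = (\<lambda>\<omega>. p * fst \<omega> + q * snd \<omega>)" and "Z = (\<lambda>\<omega>. p * fst \<omega> - q * snd \<omega> :: real)"
  have [measurable]: "fst \<in> borel_measurable R" "snd \<in> borel_measurable R"
    using measurable_fst[of S S] measurable_snd[of S S] S.events_eq_borel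
    by (simp_all add: R_def measurable_cong_sets[OF refl S.events_eq_borel])
  have [measurable]: "Y \<in> borel_measurable R" "Z \<in> borel_measurable R"
    by (auto simp: Y_def Z_def)
  have comb: "distr R borel (\<lambda>\<omega>. r * fst \<omega> + s * snd \<omega>) = normal_distribution 0 (r\<^sup>2 + s\<^sup>2)" for r s
  proof (rule Levy_uniqueness)
    show "real_distribution (distr R borel (\<lambda>\<omega>. r * fst \<omega> + s * snd \<omega>))"
      by (rule R.real_distribution_distr) simp
    show "real_distribution (normal_distribution 0 (r\<^sup>2 + s\<^sup>2))"
      by (rule real_distribution_normal_distribution) simp
    show "char (distr R borel (\<lambda>\<omega>. r * fst \<omega> + s * snd \<omega>)) = char (normal_distribution 0 (r\<^sup>2 + s\<^sup>2))"
    proof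
      fix t
      have "char (distr R borel (\<lambda>\<omega>. r * fst \<omega> + s * snd \<omega>)) t
          = (\<integral>\<omega>. iexp (t * r * fst \<omega>) * iexp (t * s * snd \<omega>) \<partial>R)"
        unfolding char_def
        by (subst integral_distr) (auto simp: exp_add[symmetric] algebra_simps)
      also have "\<dots> = (\<integral>x. \<integral>y. iexp (t * r * x) * iexp (t * s * y) \<partial>S \<partial>S)"
        unfolding R_def
        by (subst integral_fst'[symmetric])
          (auto intro!: R.integrable_const_bound[of _ 1, unfolded R_def] simp: norm_mult)
      also have "\<dots> = char S (t * r) * char S (t * s)"
        by (simp add: char_def)
      also have "\<dots> = exp (- ((r\<^sup>2 + s\<^sup>2) * t\<^sup>2) / 2)"
        by (simp add: char_std_normal_distribution S_def exp_add[symmetric] power_mult_distrib field_simps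
            flip: of_real_exp of_real_mult)
      also have "\<dots> = char (normal_distribution 0 (r\<^sup>2 + s\<^sup>2)) t"
        by (simp add: char_normal_distribution)
      finally show "char (distr R borel (\<lambda>\<omega>. r * fst \<omega> + s * snd \<omega>)) t
          = char (normal_distribution 0 (r\<^sup>2 + s\<^sup>2)) t" .
    qed
  qed
  have J: "jointly_normal R Y Z"
    unfolding jointly_normal_def
  proof (intro conjI allI)
    fix a b
    have "distr R borel (\<lambda>\<omega>. a * Y \<omega> + b * Z \<omega>)
        = normal_distribution 0 (((a + b) * p)\<^sup>2 + ((a - b) * q)\<^sup>2)"
      unfolding comb[symmetric] Y_def Z_def by (simp add: algebra_simps)
    then show "\<exists>\<mu> w. w \<ge> 0 \<and> distr R borel (\<lambda>\<omega>. a * Y \<omega> + b * Z \<omega>) = normal_distribution \<mu> w"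
      by (intro exI[of _ 0] exI[of _ "((a + b) * p)\<^sup>2 + ((a - b) * q)\<^sup>2"]) simp
  qed (use R in auto)
  have fst: "integrable R (\<lambda>\<omega>. (fst \<omega>)\<^sup>2)" "(\<integral>\<omega>. (fst \<omega>)\<^sup>2 \<partial>R) = 1"
    using normal_distribution_moments[OF _ comb[of 1 0, simplified]] by simp_all
  have snd: "integrable R (\<lambda>\<omega>. (snd \<omega>)\<^sup>2)" "(\<integral>\<omega>. (snd \<omega>)\<^sup>2 \<partial>R) = 1"
    using normal_distribution_moments[OF _ comb[of 0 1, simplified]] by simp_all
  have DY: "distr R borel Y = normal_distribution 0 v"
    using comb[of p q] pq by (simp add: Y_def field_simps)
  have DZ: "distr R borel Z = normal_distribution 0 v"
    using comb[of p "- q"] pq by (simp add: Z_def field_simps)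
  have v: "v \<ge> 0" using assms by linarith
  note momY = normal_distribution_moments[OF _ DY v] and momZ = normal_distribution_moments[OF _ DZ v]
  have "(\<integral>\<omega>. Y \<omega> * Z \<omega> \<partial>R) = (\<integral>\<omega>. p\<^sup>2 * (fst \<omega>)\<^sup>2 - q\<^sup>2 * (snd \<omega>)\<^sup>2 \<partial>R)"
    by (simp add: Y_def Z_def power2_eq_square algebra_simps)
  also have "\<dots> = c"
    using fst snd pq by (simp add: field_simps)
  finally have "(\<integral>\<omega>. Y \<omega> * Z \<omega> \<partial>R) = c" .
  with J momY momZ have "centred_normal_pair R Y Z v c"
    by (simp add: centred_normal_pair_def covariance_def)
  then show ?thesis by blast
qed

section \<open>Levy continuity under bounded weights\<close>

text \<open>The law of \<open>X\<close> after the change of measure with weight \<open>w\<close>, normalised to total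
  mass \<open>1\<close>.\<close>

definition tilted_distr :: "'a measure \<Rightarrow> ('a \<Rightarrow> real) \<Rightarrow> ('a \<Rightarrow> real) \<Rightarrow> real measure" where
  "tilted_distr N w X = distr (density N (\<lambda>\<omega>. ennreal (w \<omega> / (\<integral>\<omega>. w \<omega> \<partial>N)))) borel X"

lemma (in prob_space) weight_integral_ge_1:
  fixes w :: "'a \<Rightarrow> real"
  assumes "w \<in> borel_measurable M" "\<And>\<omega>. 1 \<le> w \<omega>" "\<And>\<omega>. w \<omega> \<le> C"
  shows "integrable M w" and "1 \<le> (\<integral>\<omega>. w \<omega> \<partial>M)"
proof -
  have "\<bar>w \<omega>\<bar> \<le> C" for \<omega>
    using assms(2,3)[of \<omega>] by auto
  then show *: "integrable M w"
    using assms(1) by (intro integrable_const_bound[of _ C]) auto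
  show "1 \<le> (\<integral>\<omega>. w \<omega> \<partial>M)"
    using integral_mono[of M "\<lambda>_. 1" w] * assms by (simp add: prob_space)
qed

lemma real_distribution_tilted_distr:
  assumes N: "prob_space N" and [measurable]: "X \<in> borel_measurable N"
    and w [measurable]: "w \<in> borel_measurable N" and b: "\<And>\<omega>. 1 \<le> w \<omega>" "\<And>\<omega>. w \<omega> \<le> C"
  shows "real_distribution (tilted_distr N w X)"
proof -
  interpret N: prob_space N by fact
  note I = N.weight_integral_ge_1[OF w b]
  have "(\<integral>\<^sup>+\<omega>. ennreal (w \<omega> / (\<integral>\<omega>. w \<omega> \<partial>N)) \<partial>N) = ennreal (\<integral>\<omega>. w \<omega> / (\<integral>\<omega>. w \<omega> \<partial>N) \<partial>N)"
    using I order_trans[OF zero_le_one b(1)]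
    by (intro nn_integral_eq_integral) (auto intro!: divide_nonneg_nonneg)
  also have "\<dots> = 1"
    using I by simp
  finally have "prob_space (density N (\<lambda>\<omega>. ennreal (w \<omega> / (\<integral>\<omega>. w \<omega> \<partial>N))))"
    by (intro prob_spaceI) (simp add: emeasure_density cong: nn_integral_cong)
  then show ?thesis
    unfolding tilted_distr_def by (rule prob_space.real_distribution_distr) simp
qed

lemma integral_tilted_distr:
  fixes h :: "real \<Rightarrow> 'b :: {banach, second_countable_topology}"
  assumes N: "prob_space N" and [measurable]: "X \<in> borel_measurable N" "h \<in> borel_measurable borel"
    and w [measurable]: "w \<in> borel_measurable N" and b: "\<And>\<omega>. 1 \<le> w \<omega>" "\<And>\<omega>. w \<omega> \<le> C"
  shows "integral\<^sup>L (tilted_distr N w X) h = (\<integral>\<omega>. w \<omega> *\<^sub>R h (X \<omega>) \<partial>N) /\<^sub>R (\<integral>\<omega>. w \<omega> \<partial>N)"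
proof -
  interpret N: prob_space N by fact
  note I = N.weight_integral_ge_1[OF w b]
  have "integral\<^sup>L (tilted_distr N w X) h
      = (\<integral>\<omega>. h (X \<omega>) \<partial>density N (\<lambda>\<omega>. ennreal (w \<omega> / (\<integral>\<omega>. w \<omega> \<partial>N))))"
    unfolding tilted_distr_def by (subst integral_distr) auto
  also have "\<dots> = (\<integral>\<omega>. (w \<omega> / (\<integral>\<omega>. w \<omega> \<partial>N)) *\<^sub>R h (X \<omega>) \<partial>N)"
    using I order_trans[OF zero_le_one b(1)]
    by (intro integral_density) (auto intro!: AE_I2 divide_nonneg_nonneg)
  also have "\<dots> = (\<integral>\<omega>. inverse (\<integral>\<omega>. w \<omega> \<partial>N) *\<^sub>R (w \<omega> *\<^sub>R h (X \<omega>)) \<partial>N)"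
    by (simp add: divide_inverse mult.commute)
  also have "\<dots> = (\<integral>\<omega>. w \<omega> *\<^sub>R h (X \<omega>) \<partial>N) /\<^sub>R (\<integral>\<omega>. w \<omega> \<partial>N)"
    by (rule integral_scaleR_right)
  finally show ?thesis .
qed

text \<open>Up to normalisation the hypothesis is convergence of the characteristic functions
  of the tilted laws. At \<open>t = 0\<close> it contains the convergence of the normalising
  constants, and weights above \<open>1\<close> keep these away from \<open>0\<close>.\<close>

lemma weighted_levy_continuity_positive:
  fixes V W :: "nat \<Rightarrow> 'a \<Rightarrow> real" and Z w :: "'b \<Rightarrow> real" and g :: "real \<Rightarrow> real"
  assumes M: "prob_space M" and P: "prob_space P"
    and V [measurable]: "\<And>n. V n \<in> borel_measurable M" and Z [measurable]: "Z \<in> borel_measurable P"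
    and W [measurable]: "\<And>n. W n \<in> borel_measurable M" and w [measurable]: "w \<in> borel_measurable P"
    and W_bounds: "\<And>n \<omega>. 1 \<le> W n \<omega>" "\<And>n \<omega>. W n \<omega> \<le> C"
    and w_bounds: "\<And>\<omega>. 1 \<le> w \<omega>" "\<And>\<omega>. w \<omega> \<le> C"
    and conv: "\<And>t. (\<lambda>n. CLINT \<omega>|M. W n \<omega> *\<^sub>R iexp (t * V n \<omega>)) \<longlonglongrightarrow> (CLINT \<omega>|P. w \<omega> *\<^sub>R iexp (t * Z \<omega>))"
    and g: "\<And>x. isCont g x" and g_bound: "\<And>x. \<bar>g x\<bar> \<le> B"
  shows "(\<lambda>n. \<integral>\<omega>. W n \<omega> * g (V n \<omega>) \<partial>M) \<longlonglongrightarrow> (\<integral>\<omega>. w \<omega> * g (Z \<omega>) \<partial>P)"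
proof -
  interpret M: prob_space M by fact
  interpret P: prob_space P by fact
  note I = M.weight_integral_ge_1[OF W W_bounds] and J = P.weight_integral_ge_1[OF w w_bounds]
  have g_meas [measurable]: "g \<in> borel_measurable borel"
    by (intro borel_measurable_continuous_onI continuous_at_imp_continuous_on ballI g)
  have "(\<lambda>n. complex_of_real (\<integral>\<omega>. W n \<omega> \<partial>M)) \<longlonglongrightarrow> complex_of_real (\<integral>\<omega>. w \<omega> \<partial>P)"
    using conv[of 0] by (simp add: scaleR_conv_of_real)
  then have mass: "(\<lambda>n. \<integral>\<omega>. W n \<omega> \<partial>M) \<longlonglongrightarrow> (\<integral>\<omega>. w \<omega> \<partial>P)"
    by (simp only: tendsto_of_real_iff)
  have dM: "real_distribution (tilted_distr M (W n) (V n))" for n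
    by (rule real_distribution_tilted_distr[OF M V W W_bounds])
  have dP: "real_distribution (tilted_distr P w Z)"
    by (rule real_distribution_tilted_distr[OF P Z w w_bounds])
  have I0: "(\<integral>\<omega>. W n \<omega> \<partial>M) \<noteq> 0" for n
    using I(2)[of n] by linarith
  have J0: "(\<integral>\<omega>. w \<omega> \<partial>P) \<noteq> 0"
    using J(2) by linarith
  have "weak_conv_m (\<lambda>n. tilted_distr M (W n) (V n)) (tilted_distr P w Z)"
  proof (rule levy_continuity[OF dM dP])
    fix t
    have "char (tilted_distr M (W n) (V n)) t
        = (CLINT \<omega>|M. W n \<omega> *\<^sub>R iexp (t * V n \<omega>)) /\<^sub>R (\<integral>\<omega>. W n \<omega> \<partial>M)" for n
      unfolding char_def by (rule integral_tilted_distr[OF M V _ W W_bounds]) simp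
    moreover have "char (tilted_distr P w Z) t
        = (CLINT \<omega>|P. w \<omega> *\<^sub>R iexp (t * Z \<omega>)) /\<^sub>R (\<integral>\<omega>. w \<omega> \<partial>P)"
      unfolding char_def by (rule integral_tilted_distr[OF P Z _ w w_bounds]) simp
    ultimately show "(\<lambda>n. char (tilted_distr M (W n) (V n)) t) \<longlonglongrightarrow> char (tilted_distr P w Z) t"
      using conv mass J0 by (auto intro!: tendsto_scaleR tendsto_inverse)
  qed
  then have "(\<lambda>n. integral\<^sup>L (tilted_distr M (W n) (V n)) g) \<longlonglongrightarrow> integral\<^sup>L (tilted_distr P w Z) g"
    using g_bound by (intro weak_conv_imp_integral_bdd_continuous_conv[OF dM dP _ g, of _ B]) auto
  then have "(\<lambda>n. (\<integral>\<omega>. W n \<omega> *\<^sub>R g (V n \<omega>) \<partial>M) /\<^sub>R (\<integral>\<omega>. W n \<omega> \<partial>M))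
      \<longlonglongrightarrow> (\<integral>\<omega>. w \<omega> *\<^sub>R g (Z \<omega>) \<partial>P) /\<^sub>R (\<integral>\<omega>. w \<omega> \<partial>P)"
    unfolding integral_tilted_distr[OF M V g_meas W W_bounds] integral_tilted_distr[OF P Z g_meas w w_bounds] .
  from tendsto_scaleR[OF mass this] show ?thesis
    using I0 J0 by (simp add: mult.assoc[symmetric])
qed

text \<open>A signed weight bounded by \<open>C\<close> is the difference of the weights \<open>w + (C + 1)\<close>
  and \<open>C + 1\<close>. The former is at least \<open>1\<close>, and the latter is a multiple of the constant weight
  \<open>1\<close>; both fall under the positive case.\<close>

lemma weighted_levy_continuity:
  fixes V W :: "nat \<Rightarrow> 'a \<Rightarrow> real" and Z w :: "'b \<Rightarrow> real" and g :: "real \<Rightarrow> real"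
  assumes M: "prob_space M" and P: "prob_space P"
    and V [measurable]: "\<And>n. V n \<in> borel_measurable M" and Z [measurable]: "Z \<in> borel_measurable P"
    and W [measurable]: "\<And>n. W n \<in> borel_measurable M" and w [measurable]: "w \<in> borel_measurable P"
    and W_bound: "\<And>n \<omega>. \<bar>W n \<omega>\<bar> \<le> C" and w_bound: "\<And>\<omega>. \<bar>w \<omega>\<bar> \<le> C"
    and conv: "\<And>t. (\<lambda>n. CLINT \<omega>|M. W n \<omega> *\<^sub>R iexp (t * V n \<omega>)) \<longlonglongrightarrow> (CLINT \<omega>|P. w \<omega> *\<^sub>R iexp (t * Z \<omega>))"
    and conv1: "\<And>t. (\<lambda>n. CLINT \<omega>|M. iexp (t * V n \<omega>)) \<longlonglongrightarrow> (CLINT \<omega>|P. iexp (t * Z \<omega>))"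
    and g: "\<And>x. isCont g x" and g_bound: "\<And>x. \<bar>g x\<bar> \<le> B"
  shows "(\<lambda>n. \<integral>\<omega>. W n \<omega> * g (V n \<omega>) \<partial>M) \<longlonglongrightarrow> (\<integral>\<omega>. w \<omega> * g (Z \<omega>) \<partial>P)"
proof -
  interpret M: prob_space M by fact
  interpret P: prob_space P by fact
  have [measurable]: "g \<in> borel_measurable borel"
    by (intro borel_measurable_continuous_onI continuous_at_imp_continuous_on ballI g)
  have bounds: "1 \<le> W n \<omega> + (C + 1)" "W n \<omega> + (C + 1) \<le> 2 * C + 1" for n \<omega>
    using W_bound[of n \<omega>] by linarith+
  have bounds': "1 \<le> w \<omega> + (C + 1)" "w \<omega> + (C + 1) \<le> 2 * C + 1" for \<omega>
    using w_bound[of \<omega>] by linarith+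
  have int: "integrable M (\<lambda>\<omega>. W n \<omega> *\<^sub>R iexp (t * V n \<omega>))" "integrable M (\<lambda>\<omega>. iexp (t * V n \<omega>))"
    "integrable M (\<lambda>\<omega>. W n \<omega> * g (V n \<omega>))" "integrable M (\<lambda>\<omega>. g (V n \<omega>))" for n t
  proof -
    have "\<bar>W n \<omega>\<bar> * \<bar>g (V n \<omega>)\<bar> \<le> C * B" for \<omega>
      using W_bound[of n] g_bound order_trans[OF abs_ge_zero W_bound[of n]] by (intro mult_mono) auto
    then show "integrable M (\<lambda>\<omega>. W n \<omega> *\<^sub>R iexp (t * V n \<omega>))" "integrable M (\<lambda>\<omega>. iexp (t * V n \<omega>))"
      "integrable M (\<lambda>\<omega>. W n \<omega> * g (V n \<omega>))" "integrable M (\<lambda>\<omega>. g (V n \<omega>))"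
      using W_bound[of n] g_bound
      by (simp_all add: M.integrable_const_bound[of _ C] M.integrable_const_bound[of _ 1]
          M.integrable_const_bound[of _ "C * B"] M.integrable_const_bound[of _ B] abs_mult)
  qed
  have int': "integrable P (\<lambda>\<omega>. w \<omega> *\<^sub>R iexp (t * Z \<omega>))" "integrable P (\<lambda>\<omega>. iexp (t * Z \<omega>))"
    "integrable P (\<lambda>\<omega>. w \<omega> * g (Z \<omega>))" "integrable P (\<lambda>\<omega>. g (Z \<omega>))" for t
  proof -
    have "\<bar>w \<omega>\<bar> * \<bar>g (Z \<omega>)\<bar> \<le> C * B" for \<omega>
      using w_bound g_bound order_trans[OF abs_ge_zero w_bound] by (intro mult_mono) auto
    then show "integrable P (\<lambda>\<omega>. w \<omega> *\<^sub>R iexp (t * Z \<omega>))" "integrable P (\<lambda>\<omega>. iexp (t * Z \<omega>))"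
      "integrable P (\<lambda>\<omega>. w \<omega> * g (Z \<omega>))" "integrable P (\<lambda>\<omega>. g (Z \<omega>))"
      using w_bound g_bound
      by (simp_all add: P.integrable_const_bound[of _ C] P.integrable_const_bound[of _ 1]
          P.integrable_const_bound[of _ "C * B"] P.integrable_const_bound[of _ B] abs_mult)
  qed
  have "(\<lambda>n. \<integral>\<omega>. (W n \<omega> + (C + 1)) * g (V n \<omega>) \<partial>M) \<longlonglongrightarrow> (\<integral>\<omega>. (w \<omega> + (C + 1)) * g (Z \<omega>) \<partial>P)"
  proof (rule weighted_levy_continuity_positive[OF M P V Z _ _ bounds bounds' _ g g_bound])
    fix t
    show "(\<lambda>n. CLINT \<omega>|M. (W n \<omega> + (C + 1)) *\<^sub>R iexp (t * V n \<omega>))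
        \<longlonglongrightarrow> (CLINT \<omega>|P. (w \<omega> + (C + 1)) *\<^sub>R iexp (t * Z \<omega>))"
      unfolding scaleR_add_left[of "W _ _"] scaleR_add_left[of "w _"]
      using int int' by (simp only: Bochner_Integration.integral_add integrable_scaleR_right
        integral_scaleR_right) (intro tendsto_add tendsto_scaleR tendsto_const conv conv1)
  qed auto
  moreover have "(\<lambda>n. \<integral>\<omega>. 1 * g (V n \<omega>) \<partial>M) \<longlonglongrightarrow> (\<integral>\<omega>. 1 * g (Z \<omega>) \<partial>P)"
    by (rule weighted_levy_continuity_positive[OF M P V Z _ _ _ _ _ _ _ g g_bound, where C = 1])
      (use conv1 in auto)
  ultimately have "(\<lambda>n. (\<integral>\<omega>. (W n \<omega> + (C + 1)) * g (V n \<omega>) \<partial>M) - (C + 1) * (\<integral>\<omega>. 1 * g (V n \<omega>) \<partial>M))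
      \<longlonglongrightarrow> (\<integral>\<omega>. (w \<omega> + (C + 1)) * g (Z \<omega>) \<partial>P) - (C + 1) * (\<integral>\<omega>. 1 * g (Z \<omega>) \<partial>P)"
    by (intro tendsto_diff tendsto_mult tendsto_const)
  then show ?thesis
    using int int' by (simp add: distrib_right[of "W _ _"] distrib_right[of "w _"])
qed

section \<open>Joint convergence from linear combinations\<close>

text \<open>Trigonometric weights in \<open>U\<close> are bounded and real, and their weighted characteristic
  functions in \<open>V\<close> are combinations of values of the joint characteristic function.\<close>

lemma (in prob_space) integral_trig_weight:
  fixes U V :: "'a \<Rightarrow> real"
  assumes [measurable]: "U \<in> borel_measurable M" "V \<in> borel_measurable M"
  shows "(CLINT \<omega>|M. cos (a * U \<omega>) *\<^sub>R iexp (t * V \<omega>))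
      = ((CLINT \<omega>|M. iexp (a * U \<omega> + t * V \<omega>)) + (CLINT \<omega>|M. iexp (- a * U \<omega> + t * V \<omega>))) / 2"
    and "(CLINT \<omega>|M. sin (a * U \<omega>) *\<^sub>R iexp (t * V \<omega>))
      = \<i> / 2 * ((CLINT \<omega>|M. iexp (- a * U \<omega> + t * V \<omega>)) - (CLINT \<omega>|M. iexp (a * U \<omega> + t * V \<omega>)))"
proof -
  have int: "integrable M (\<lambda>\<omega>. iexp (b * U \<omega> + t * V \<omega>))" for b
    by (intro integrable_const_bound[of _ 1]) auto
  have c: "cos x *\<^sub>R iexp y = (iexp (x + y) + iexp (- x + y)) / 2" for x y
    by (simp add: complex_eq_iff Re_exp Im_exp cos_add sin_add cos_diff sin_diff)
  have s: "sin x *\<^sub>R iexp y = \<i> / 2 * (iexp (- x + y) - iexp (x + y))" for x y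
    by (simp add: complex_eq_iff Re_exp Im_exp cos_add sin_add cos_diff sin_diff)
  show "(CLINT \<omega>|M. cos (a * U \<omega>) *\<^sub>R iexp (t * V \<omega>))
      = ((CLINT \<omega>|M. iexp (a * U \<omega> + t * V \<omega>)) + (CLINT \<omega>|M. iexp (- a * U \<omega> + t * V \<omega>))) / 2"
    unfolding c using int[of a] int[of "- a"]
    by (simp only: minus_mult_left integral_divide_zero Bochner_Integration.integral_add)
  show "(CLINT \<omega>|M. sin (a * U \<omega>) *\<^sub>R iexp (t * V \<omega>))
      = \<i> / 2 * ((CLINT \<omega>|M. iexp (- a * U \<omega> + t * V \<omega>)) - (CLINT \<omega>|M. iexp (a * U \<omega> + t * V \<omega>)))"
    unfolding s using int[of a] int[of "- a"]
    by (simp only: minus_mult_left integral_mult_right_zero Bochner_Integration.integral_diff)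
qed

lemma (in prob_space) integral_weight_iexp:
  fixes U h :: "'a \<Rightarrow> real"
  assumes [measurable]: "U \<in> borel_measurable M" "h \<in> borel_measurable M"
    and h: "\<And>\<omega>. \<bar>h \<omega>\<bar> \<le> C"
  shows "(CLINT \<omega>|M. h \<omega> *\<^sub>R iexp (a * U \<omega>))
      = complex_of_real (\<integral>\<omega>. cos (a * U \<omega>) * h \<omega> \<partial>M) + \<i> * complex_of_real (\<integral>\<omega>. sin (a * U \<omega>) * h \<omega> \<partial>M)"
proof -
  have "\<bar>cos x * h \<omega>\<bar> \<le> 1 * C" "\<bar>sin x * h \<omega>\<bar> \<le> 1 * C" for x \<omega>
    unfolding abs_mult using h by (intro mult_mono; simp)+
  then have int: "integrable M (\<lambda>\<omega>. cos (a * U \<omega>) * h \<omega>)" "integrable M (\<lambda>\<omega>. sin (a * U \<omega>) * h \<omega>)"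
    by (auto intro!: integrable_const_bound[of _ C])
  have "h \<omega> *\<^sub>R iexp x = complex_of_real (cos x * h \<omega>) + \<i> * complex_of_real (sin x * h \<omega>)" for x \<omega>
    by (simp add: complex_eq_iff Re_exp Im_exp mult.commute)
  then show ?thesis
    using int by (simp only: Bochner_Integration.integral_add integrable_of_real integral_complex_of_real
        integrable_mult_right integral_mult_right_zero)
qed

text \<open>A two-dimensional continuity theorem for test functions of product form. First
  \<open>cos (a U\<^sub>n)\<close> and \<open>sin (a U\<^sub>n)\<close> serve as weights for \<open>V\<^sub>n\<close>, which replaces the exponential in \<open>V\<^sub>n\<close>
  by \<open>h(V\<^sub>n)\<close>; the result is the characteristic function of \<open>U\<^sub>n\<close> under the weight
  \<open>h(V\<^sub>n)\<close>, to which the weighted theorem applies again.\<close>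

lemma joint_levy_continuity:
  fixes U V :: "nat \<Rightarrow> 'a \<Rightarrow> real" and Y Z :: "'b \<Rightarrow> real" and g h :: "real \<Rightarrow> real"
  assumes M: "prob_space M" and P: "prob_space P"
    and U [measurable]: "\<And>n. U n \<in> borel_measurable M" and V [measurable]: "\<And>n. V n \<in> borel_measurable M"
    and Y [measurable]: "Y \<in> borel_measurable P" and Z [measurable]: "Z \<in> borel_measurable P"
    and conv: "\<And>a b. (\<lambda>n. CLINT \<omega>|M. iexp (a * U n \<omega> + b * V n \<omega>))
      \<longlonglongrightarrow> (CLINT \<omega>|P. iexp (a * Y \<omega> + b * Z \<omega>))"
    and g: "\<And>x. isCont g x" "\<And>x. \<bar>g x\<bar> \<le> B"
    and h: "\<And>x. isCont h x" "\<And>x. \<bar>h x\<bar> \<le> C"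
  shows "(\<lambda>n. \<integral>\<omega>. g (U n \<omega>) * h (V n \<omega>) \<partial>M) \<longlonglongrightarrow> (\<integral>\<omega>. g (Y \<omega>) * h (Z \<omega>) \<partial>P)"
proof -
  interpret M: prob_space M by fact
  interpret P: prob_space P by fact
  have [measurable]: "h \<in> borel_measurable borel"
    by (intro borel_measurable_continuous_onI continuous_at_imp_continuous_on ballI h)
  have convU: "(\<lambda>n. CLINT \<omega>|M. iexp (t * U n \<omega>)) \<longlonglongrightarrow> (CLINT \<omega>|P. iexp (t * Y \<omega>))" for t
    using conv[of t 0] by simp
  have convV: "(\<lambda>n. CLINT \<omega>|M. iexp (t * V n \<omega>)) \<longlonglongrightarrow> (CLINT \<omega>|P. iexp (t * Z \<omega>))" for t
    using conv[of 0 t] by simp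
  have cos_conv: "(\<lambda>n. \<integral>\<omega>. cos (a * U n \<omega>) * h (V n \<omega>) \<partial>M) \<longlonglongrightarrow> (\<integral>\<omega>. cos (a * Y \<omega>) * h (Z \<omega>) \<partial>P)" for a
  proof (rule weighted_levy_continuity[OF M P V Z _ _ _ _ _ convV h, where C = 1])
    fix t
    show "(\<lambda>n. CLINT \<omega>|M. cos (a * U n \<omega>) *\<^sub>R iexp (t * V n \<omega>))
        \<longlonglongrightarrow> (CLINT \<omega>|P. cos (a * Y \<omega>) *\<^sub>R iexp (t * Z \<omega>))"
      unfolding M.integral_trig_weight[OF U V] P.integral_trig_weight[OF Y Z]
      by (intro tendsto_intros conv) auto
  qed auto
  have sin_conv: "(\<lambda>n. \<integral>\<omega>. sin (a * U n \<omega>) * h (V n \<omega>) \<partial>M) \<longlonglongrightarrow> (\<integral>\<omega>. sin (a * Y \<omega>) * h (Z \<omega>) \<partial>P)" for a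
  proof (rule weighted_levy_continuity[OF M P V Z _ _ _ _ _ convV h, where C = 1])
    fix t
    show "(\<lambda>n. CLINT \<omega>|M. sin (a * U n \<omega>) *\<^sub>R iexp (t * V n \<omega>))
        \<longlonglongrightarrow> (CLINT \<omega>|P. sin (a * Y \<omega>) *\<^sub>R iexp (t * Z \<omega>))"
      unfolding M.integral_trig_weight[OF U V] P.integral_trig_weight[OF Y Z]
      by (intro tendsto_intros conv) auto
  qed auto
  have "(\<lambda>n. \<integral>\<omega>. h (V n \<omega>) * g (U n \<omega>) \<partial>M) \<longlonglongrightarrow> (\<integral>\<omega>. h (Z \<omega>) * g (Y \<omega>) \<partial>P)"
  proof (rule weighted_levy_continuity[OF M P U Y _ _ h(2) h(2) _ convU g])
    fix a
    have "(CLINT \<omega>|M. h (V n \<omega>) *\<^sub>R iexp (a * U n \<omega>))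
        = complex_of_real (\<integral>\<omega>. cos (a * U n \<omega>) * h (V n \<omega>) \<partial>M)
          + \<i> * complex_of_real (\<integral>\<omega>. sin (a * U n \<omega>) * h (V n \<omega>) \<partial>M)" for n
      using h(2) by (intro M.integral_weight_iexp) auto
    moreover have "(CLINT \<omega>|P. h (Z \<omega>) *\<^sub>R iexp (a * Y \<omega>))
        = complex_of_real (\<integral>\<omega>. cos (a * Y \<omega>) * h (Z \<omega>) \<partial>P)
          + \<i> * complex_of_real (\<integral>\<omega>. sin (a * Y \<omega>) * h (Z \<omega>) \<partial>P)"
      using h(2) by (intro P.integral_weight_iexp) auto
    ultimately show "(\<lambda>n. CLINT \<omega>|M. h (V n \<omega>) *\<^sub>R iexp (a * U n \<omega>))
        \<longlonglongrightarrow> (CLINT \<omega>|P. h (Z \<omega>) *\<^sub>R iexp (a * Y \<omega>))"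
      by (simp only:) (intro tendsto_intros cos_conv sin_conv)
  qed auto
  then show ?thesis
    by (simp add: mult.commute)
qed

section \<open>Weak convergence of minima\<close>

text \<open>At a continuity point \<open>x\<close> of the limit, \<open>q\<close> on a short interval to the right of
  \<open>x\<close> bounds the distribution functions from above, and \<open>q\<close> on a short interval to the left
  bounds them from below.\<close>

lemma weak_conv_m_sandwichI:
  assumes bound: "\<And>a b n. a < b \<Longrightarrow> cdf (\<mu> n) a \<le> q n a b \<and> q n a b \<le> cdf (\<mu> n) b"
    and bound': "\<And>a b. a < b \<Longrightarrow> cdf \<nu> a \<le> q' a b \<and> q' a b \<le> cdf \<nu> b"
    and conv: "\<And>a b. a < b \<Longrightarrow> (\<lambda>n. q n a b) \<longlonglongrightarrow> q' a b"
  shows "weak_conv_m \<mu> \<nu>"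
  unfolding weak_conv_m_def weak_conv_def
proof (intro allI impI)
  fix x assume cont: "isCont (cdf \<nu>) x"
  show "(\<lambda>n. cdf (\<mu> n) x) \<longlonglongrightarrow> cdf \<nu> x"
  proof (rule order_tendstoI)
    fix l assume "l < cdf \<nu> x"
    then have "\<forall>\<^sub>F y in at x. l < cdf \<nu> y"
      using cont by (auto simp: isCont_def dest: order_tendstoD)
    then obtain \<delta> where "\<delta> > 0" and \<delta>: "\<And>y. y \<noteq> x \<Longrightarrow> dist y x < \<delta> \<Longrightarrow> l < cdf \<nu> y"
      by (auto simp: eventually_at)
    define a where "a = x - \<delta> / 2"
    have a: "a < x" "l < cdf \<nu> a"
      using \<open>\<delta> > 0\<close> \<delta>[of a] by (auto simp: a_def dist_real_def)
    then have "l < q' a x"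
      using bound'[of a x] by linarith
    then have "\<forall>\<^sub>F n in sequentially. l < q n a x"
      using conv[OF a(1)] by (auto dest: order_tendstoD)
    then show "\<forall>\<^sub>F n in sequentially. l < cdf (\<mu> n) x"
      by eventually_elim (use bound[OF a(1)] in \<open>auto intro: less_le_trans\<close>)
  next
    fix r assume "cdf \<nu> x < r"
    then have "\<forall>\<^sub>F y in at x. cdf \<nu> y < r"
      using cont by (auto simp: isCont_def dest: order_tendstoD)
    then obtain \<delta> where "\<delta> > 0" and \<delta>: "\<And>y. y \<noteq> x \<Longrightarrow> dist y x < \<delta> \<Longrightarrow> cdf \<nu> y < r"
      by (auto simp: eventually_at)
    define b where "b = x + \<delta> / 2"
    have b: "x < b" "cdf \<nu> b < r"
      using \<open>\<delta> > 0\<close> \<delta>[of b] by (auto simp: b_def dist_real_def)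
    then have "q' x b < r"
      using bound'[of x b] by linarith
    then have "\<forall>\<^sub>F n in sequentially. q n x b < r"
      using conv[OF b(1)] by (auto dest: order_tendstoD)
    then show "\<forall>\<^sub>F n in sequentially. cdf (\<mu> n) x < r"
      by eventually_elim (use bound[OF b(1)] in \<open>auto intro: le_less_trans\<close>)
  qed
qed

lemma isCont_cts_step: "a < b \<Longrightarrow> isCont (cts_step a b) x"
  using cts_step_uniformly_continuous[of a b]
  by (auto dest!: uniformly_continuous_imp_continuous simp: continuous_on_eq_continuous_at)

text \<open>The function \<open>1 - cts_step a b\<close> climbs from \<open>0\<close> at \<open>a\<close> to \<open>1\<close> at \<open>b\<close>. The product
  of its values at \<open>U\<close> and \<open>V\<close> is a continuous substitute for the indicator that both variables,
  equivalently their minimum, exceed a threshold between \<open>a\<close> and \<open>b\<close>.\<close>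

lemma (in prob_space) cdf_min_sandwich:
  fixes U V :: "'a \<Rightarrow> real"
  assumes U [measurable]: "U \<in> borel_measurable M" and V [measurable]: "V \<in> borel_measurable M" and ab: "a < b"
  defines "q \<equiv> 1 - (\<integral>\<omega>. (1 - cts_step a b (U \<omega>)) * (1 - cts_step a b (V \<omega>)) \<partial>M)"
    and "D \<equiv> distr M borel (\<lambda>\<omega>. min (U \<omega>) (V \<omega>))"
  shows "cdf D a \<le> q" and "q \<le> cdf D b"
proof -
  define k where "k x = 1 - cts_step a b x" for x
  have k01: "0 \<le> k x" "k x \<le> 1" and k0: "x \<le> a \<Longrightarrow> k x = 0" and k1: "b < x \<Longrightarrow> k x = 1" for x
    using ab by (auto simp: k_def cts_step_def)
  have "continuous_on UNIV (cts_step a b)"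
    using ab by (intro continuous_at_imp_continuous_on ballI isCont_cts_step)
  then have [measurable]: "k \<in> borel_measurable borel"
    unfolding k_def by (intro borel_measurable_diff borel_measurable_const borel_measurable_continuous_onI)
  have kk: "0 \<le> k x * k y" "k x * k y \<le> 1" for x y
    using k01 mult_mono[of "k x" 1 "k y" 1] by auto
  then have int: "integrable M (\<lambda>\<omega>. k (U \<omega>) * k (V \<omega>))"
    by (intro integrable_const_bound[of _ 1]) auto
  have cdf: "cdf D t = (\<integral>\<omega>. indicator {..t} (min (U \<omega>) (V \<omega>)) \<partial>M)" for t
  proof -
    have "cdf D t = integral\<^sup>L D (indicator {..t})"
      by (simp add: cdf_def D_def)
    then show ?thesis
      unfolding D_def by (subst (asm) integral_distr) auto
  qed
  have q: "q = (\<integral>\<omega>. 1 - k (U \<omega>) * k (V \<omega>) \<partial>M)"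
    unfolding q_def k_def[symmetric] using int by (simp add: prob_space)
  have int': "integrable M (\<lambda>\<omega>. 1 - k (U \<omega>) * k (V \<omega>))"
    using int by simp
  have indi: "integrable M (\<lambda>\<omega>. indicator {..t} (min (U \<omega>) (V \<omega>)) :: real)" for t
    by (intro integrable_const_bound[of _ 1]) (auto split: split_indicator)
  show "cdf D a \<le> q"
    unfolding cdf q using k0 kk indi int'
    by (intro integral_mono) (auto split: split_indicator simp: min_le_iff_disj)
  show "q \<le> cdf D b"
    unfolding cdf q using k1 kk indi int'
    by (intro integral_mono) (auto split: split_indicator simp: min_le_iff_disj not_le)
qed

lemma weak_conv_m_min:
  fixes U V :: "nat \<Rightarrow> 'a \<Rightarrow> real" and Y Z :: "'b \<Rightarrow> real"
  assumes M: "prob_space M" and P: "prob_space P"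
    and U: "\<And>n. U n \<in> borel_measurable M" and V: "\<And>n. V n \<in> borel_measurable M"
    and Y: "Y \<in> borel_measurable P" and Z: "Z \<in> borel_measurable P"
    and conv: "\<And>a b. (\<lambda>n. CLINT \<omega>|M. iexp (a * U n \<omega> + b * V n \<omega>))
      \<longlonglongrightarrow> (CLINT \<omega>|P. iexp (a * Y \<omega> + b * Z \<omega>))"
  shows "weak_conv_m (\<lambda>n. distr M borel (\<lambda>\<omega>. min (U n \<omega>) (V n \<omega>)))
    (distr P borel (\<lambda>\<omega>. min (Y \<omega>) (Z \<omega>)))"
proof (rule weak_conv_m_sandwichI)
  fix a b :: real assume ab: "a < b"
  let ?k = "\<lambda>x. 1 - cts_step a b x"
  show "cdf (distr M borel (\<lambda>\<omega>. min (U n \<omega>) (V n \<omega>))) a \<le> 1 - (\<integral>\<omega>. ?k (U n \<omega>) * ?k (V n \<omega>) \<partial>M)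
      \<and> 1 - (\<integral>\<omega>. ?k (U n \<omega>) * ?k (V n \<omega>) \<partial>M) \<le> cdf (distr M borel (\<lambda>\<omega>. min (U n \<omega>) (V n \<omega>))) b" for n
    using prob_space.cdf_min_sandwich[OF M U V ab] by blast
  show "cdf (distr P borel (\<lambda>\<omega>. min (Y \<omega>) (Z \<omega>))) a \<le> 1 - (\<integral>\<omega>. ?k (Y \<omega>) * ?k (Z \<omega>) \<partial>P)
      \<and> 1 - (\<integral>\<omega>. ?k (Y \<omega>) * ?k (Z \<omega>) \<partial>P) \<le> cdf (distr P borel (\<lambda>\<omega>. min (Y \<omega>) (Z \<omega>))) b"
    using prob_space.cdf_min_sandwich[OF P Y Z ab] by blast
  have k: "isCont ?k x" "\<bar>?k x\<bar> \<le> 1" for x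
  proof -
    show "isCont ?k x"
      by (intro isCont_diff continuous_const isCont_cts_step[OF ab])
    show "\<bar>?k x\<bar> \<le> 1"
      using ab by (auto simp: cts_step_def field_simps)
  qed
  show "(\<lambda>n. 1 - (\<integral>\<omega>. ?k (U n \<omega>) * ?k (V n \<omega>) \<partial>M)) \<longlonglongrightarrow> 1 - (\<integral>\<omega>. ?k (Y \<omega>) * ?k (Z \<omega>) \<partial>P)"
    by (intro tendsto_diff tendsto_const joint_levy_continuity[OF M P U V Y Z conv k k])
qed

text \<open>The minimum is at most \<open>x\<close> if \<open>U\<^sub>n\<close> is, and otherwise only if
  \<open>V\<^sub>n \<le> x - c\<^sub>n\<close>. The probability of the latter vanishes because a weakly convergent sequence
  loses no mass at minus infinity.\<close>

lemma weak_conv_m_min_shifted: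
  fixes U V :: "nat \<Rightarrow> 'a \<Rightarrow> real" and c :: "nat \<Rightarrow> real"
  assumes M: "prob_space M"
    and U [measurable]: "\<And>n. U n \<in> borel_measurable M" and V [measurable]: "\<And>n. V n \<in> borel_measurable M"
    and \<nu>: "real_distribution \<nu>"
    and convU: "weak_conv_m (\<lambda>n. distr M borel (U n)) \<mu>"
    and convV: "weak_conv_m (\<lambda>n. distr M borel (V n)) \<nu>"
    and c: "filterlim c at_top sequentially"
  shows "weak_conv_m (\<lambda>n. distr M borel (\<lambda>\<omega>. min (U n \<omega>) (V n \<omega> + c n))) \<mu>"
proof -
  interpret M: prob_space M by fact
  interpret \<nu>: real_distribution \<nu> by fact
  have rd: "real_distribution (distr M borel X)" if "X \<in> borel_measurable M" for X :: "'a \<Rightarrow> real"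
    using that by (rule M.real_distribution_distr)
  have cdf: "cdf (distr M borel X) x = measure M {\<omega> \<in> space M. X \<omega> \<le> x}"
    if "X \<in> borel_measurable M" for X :: "'a \<Rightarrow> real" and x
    using that by (auto simp: cdf_def measure_distr vimage_def Int_def intro!: arg_cong[where f = "measure M"])
  have tail: "(\<lambda>n. measure M {\<omega> \<in> space M. V n \<omega> + c n \<le> x}) \<longlonglongrightarrow> 0" for x
  proof (rule order_tendstoI)
    fix r :: real assume "0 < r"
    then have "\<forall>\<^sub>F s in at_bot. cdf \<nu> s < r"
      using \<nu>.cdf_lim_at_bot by (auto dest: order_tendstoD)
    then obtain s where s: "cdf \<nu> s < r"
      using eventually_happens'[OF trivial_limit_at_bot_linorder] by blast
    have "(\<lambda>n. integral\<^sup>L (distr M borel (V n)) (cts_step (s - 1) s)) \<longlonglongrightarrow> integral\<^sup>L \<nu> (cts_step (s - 1) s)"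
      by (rule weak_conv_imp_integral_bdd_continuous_conv[OF rd[OF V] \<nu> convV isCont_cts_step, where B = 1])
        (auto simp: cts_step_def field_simps)
    moreover have "integral\<^sup>L \<nu> (cts_step (s - 1) s) < r"
      using \<nu>.cdf_cts_step(2)[of "s - 1" s] s by simp
    ultimately have "\<forall>\<^sub>F n in sequentially. integral\<^sup>L (distr M borel (V n)) (cts_step (s - 1) s) < r"
      by (rule order_tendstoD(2))
    moreover have "\<forall>\<^sub>F n in sequentially. x - (s - 1) \<le> c n"
      using c by (simp add: filterlim_at_top)
    ultimately show "\<forall>\<^sub>F n in sequentially. measure M {\<omega> \<in> space M. V n \<omega> + c n \<le> x} < r"
    proof eventually_elim
      case (elim n)
      have "measure M {\<omega> \<in> space M. V n \<omega> + c n \<le> x} \<le> measure M {\<omega> \<in> space M. V n \<omega> \<le> s - 1}"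
        using elim by (intro M.finite_measure_mono) auto
      also have "\<dots> = cdf (distr M borel (V n)) (s - 1)"
        using V by (rule cdf[symmetric])
      also have "\<dots> \<le> integral\<^sup>L (distr M borel (V n)) (cts_step (s - 1) s)"
        by (rule real_distribution.cdf_cts_step(1)[OF rd[OF V]]) simp
      finally show ?case using elim by simp
    qed
  qed (simp add: less_le_trans[OF _ measure_nonneg])
  show ?thesis
    unfolding weak_conv_m_def weak_conv_def
  proof (intro allI impI)
    fix x assume "isCont (cdf \<mu>) x"
    then have lim: "(\<lambda>n. cdf (distr M borel (U n)) x) \<longlonglongrightarrow> cdf \<mu> x"
      using convU by (simp add: weak_conv_m_def weak_conv_def)
    let ?D = "\<lambda>n. distr M borel (\<lambda>\<omega>. min (U n \<omega>) (V n \<omega> + c n))"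
    let ?tail = "\<lambda>n. measure M {\<omega> \<in> space M. V n \<omega> + c n \<le> x}"
    have lower: "cdf (distr M borel (U n)) x \<le> cdf (?D n) x" for n
      by (simp add: cdf) (intro M.finite_measure_mono, auto)
    have upper: "cdf (?D n) x \<le> cdf (distr M borel (U n)) x + ?tail n" for n
    proof -
      have "cdf (?D n) x \<le> measure M ({\<omega> \<in> space M. U n \<omega> \<le> x} \<union> {\<omega> \<in> space M. V n \<omega> + c n \<le> x})"
        by (simp add: cdf) (intro M.finite_measure_mono, auto)
      also have "\<dots> \<le> measure M {\<omega> \<in> space M. U n \<omega> \<le> x} + ?tail n"
        by (intro measure_Un_le) auto
      finally show ?thesis by (simp add: cdf)
    qed
    show "(\<lambda>n. cdf (?D n) x) \<longlonglongrightarrow> cdf \<mu> x"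
    proof (rule tendsto_sandwich[OF _ _ lim])
      show "(\<lambda>n. cdf (distr M borel (U n)) x + ?tail n) \<longlonglongrightarrow> cdf \<mu> x"
        using tendsto_add[OF lim tail] by simp
    qed (use lower upper in auto)
  qed
qed

section \<open>Empirical masses of measurable sets\<close>

text \<open>A form of the central limit theorem that includes variance \<open>0\<close>, where the
  summands almost surely equal their mean. This case cannot be avoided: a linear combination of
  the two indicators may well be almost surely constant.\<close>

lemma (in prob_space) central_limit_theorem_iexp:
  fixes Y :: "nat \<Rightarrow> 'a \<Rightarrow> real"
  assumes indep: "indep_vars (\<lambda>_. borel) Y UNIV"
    and mean: "\<And>n. expectation (Y n) = m"
    and sq: "\<And>n. integrable M (\<lambda>\<omega>. (Y n \<omega>)\<^sup>2)"
    and var: "\<And>n. variance (Y n) = v"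
    and distr: "\<And>n. distr M borel (Y n) = \<mu>"
  shows "(\<lambda>n. CLINT \<omega>|M. iexp (t * ((\<Sum>i<n. Y i \<omega> - m) / sqrt n)))
    \<longlonglongrightarrow> complex_of_real (exp (- (v * t\<^sup>2) / 2))"
proof -
  have Y [measurable]: "Y n \<in> borel_measurable M" for n
    using indep unfolding indep_vars_def2 by simp
  have int: "integrable M (Y n)" for n
    by (rule square_integrable_imp_integrable[OF _ sq]) simp
  have v: "v \<ge> 0"
    using var[of 0] by (auto intro!: Bochner_Integration.integral_nonneg)
  show ?thesis
  proof (cases "v = 0")
    case True
    have "integrable M (\<lambda>\<omega>. (Y n \<omega> - m)\<^sup>2)" for n
      using int sq by (simp add: power2_diff)
    then have "AE \<omega> in M. (Y n \<omega> - m)\<^sup>2 = 0" for n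
      using var[of n] True by (subst integral_nonneg_eq_0_iff_AE[symmetric]) (auto simp: mean)
    then have "AE \<omega> in M. \<forall>n. Y n \<omega> = m"
      by (subst AE_all_countable) simp
    then have "(CLINT \<omega>|M. iexp (t * ((\<Sum>i<n. Y i \<omega> - m) / sqrt n))) = (CLINT \<omega>|M. 1)" for n
      by (intro integral_cong_AE) auto
    then show ?thesis
      using True by (simp add: prob_space)
  next
    case False
    with v have v: "v > 0" by simp
    \<comment> \<open>The classical theorem normalises to variance \<open>1\<close>; evaluating at \<open>t * sqrt v\<close> undoes this.\<close>
    let ?D = "\<lambda>n. distr M borel (\<lambda>\<omega>. (\<Sum>i<n. Y i \<omega> - m) / sqrt (real n * (sqrt v)\<^sup>2))"
    have "weak_conv_m ?D std_normal_distribution"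
      using v by (intro central_limit_theorem[OF indep mean _ sq _ distr]) (auto simp: var)
    then have "(\<lambda>n. char (?D n) (t * sqrt v)) \<longlonglongrightarrow> char std_normal_distribution (t * sqrt v)"
      by (intro levy_continuity1 real_dist_normal_dist real_distribution_distr) simp_all
    moreover have "char (?D n) (t * sqrt v) = (CLINT \<omega>|M. iexp (t * ((\<Sum>i<n. Y i \<omega> - m) / sqrt n)))" for n
      unfolding char_def using v by (subst integral_distr) (auto simp: real_sqrt_mult)
    moreover have "char std_normal_distribution (t * sqrt v) = complex_of_real (exp (- (v * t\<^sup>2) / 2))"
      using v by (simp add: char_std_normal_distribution power_mult_distrib mult.commute)
    ultimately show ?thesis by simp
  qed
qed

lemma measure_empirical_distribution:
  assumes [measurable]: "A \<in> sets borel"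
  shows "measure (empirical_distribution n y) A = (\<Sum>i<n. indicator A (y i)) / real n"
proof -
  have y: "y \<in> measurable (uniform_count_measure {..<n}) borel"
    by (simp add: measurable_def space_uniform_count_measure sets_uniform_count_measure)
  have "measure (empirical_distribution n y) A = measure (uniform_count_measure {..<n}) (y -` A \<inter> {..<n})"
    unfolding empirical_distribution_def using y
    by (simp add: measure_distr space_uniform_count_measure)
  also have "\<dots> = real (card (y -` A \<inter> {..<n})) / real n"
    by (simp add: measure_uniform_count_measure)
  also have "real (card (y -` A \<inter> {..<n})) = (\<Sum>i<n. indicator (y -` A) i)"
    by (simp add: indicator_def sum.If_cases Int_commute vimage_def)
  finally show ?thesis
    by (simp add: indicator_def vimage_def)
qed

locale iid_sample = prob_space M
  for M :: "'w measure" +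
  fixes X :: "nat \<Rightarrow> 'w \<Rightarrow> 'x :: topological_space" and F :: "'x measure"
  assumes indep: "indep_vars (\<lambda>_. borel) X UNIV"
    and distr_X: "\<And>i. distr M borel (X i) = F"
begin

definition empirical_process :: "'x set \<Rightarrow> nat \<Rightarrow> 'w \<Rightarrow> real" where
  "empirical_process A n \<omega>
    = sqrt (real n) * (measure (empirical_distribution n (\<lambda>i. X i \<omega>)) A - measure F A)"

lemma measurable_X [measurable]: "X i \<in> borel_measurable M"
  using indep unfolding indep_vars_def2 by simp

lemma empirical_process_eq:
  assumes "A \<in> sets borel"
  shows "empirical_process A n \<omega> = (\<Sum>i<n. indicator A (X i \<omega>) - measure F A) / sqrt (real n)"
proof (cases "n = 0")
  case False
  then have "sqrt (real n) * (S / real n - p) = (S - real n * p) / sqrt (real n)" for S p :: real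
    by (simp add: field_simps real_sqrt_mult[symmetric])
  then show ?thesis
    by (simp add: empirical_process_def measure_empirical_distribution[OF assms] sum_subtractf)
qed (simp add: empirical_process_def)

lemma measurable_empirical_process [measurable]:
  assumes [measurable]: "A \<in> sets borel"
  shows "empirical_process A n \<in> borel_measurable M"
  unfolding empirical_process_eq[OF assms] by measurable

lemma expectation_indicator:
  assumes [measurable]: "A \<in> sets borel"
  shows "expectation (\<lambda>\<omega>. indicator A (X i \<omega>)) = measure F A"
proof -
  have "expectation (\<lambda>\<omega>. indicator A (X i \<omega>) :: real) = integral\<^sup>L (distr M borel (X i)) (indicator A)"
    by (subst integral_distr) auto
  also have "\<dots> = measure F A"
    unfolding distr_X using arg_cong[OF distr_X[of i], of space] arg_cong[OF distr_X[of i], of sets] by simp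
  finally show ?thesis .
qed

text \<open>The combination is a normalised sum of the variables \<open>h(X\<^sub>i)\<close> for
  \<open>h = a 1\<^sub>A + b 1\<^sub>B\<close>. Since \<open>A\<close> and \<open>B\<close> essentially do not overlap, the mixed term in the second
  moment of \<open>h\<close> is \<open>0\<close>, which makes the covariance of the two indicators \<open>- p q\<close>.\<close>

lemma empirical_process_iexp:
  assumes A [measurable]: "A \<in> sets borel" and B [measurable]: "B \<in> sets borel"
    and null: "measure F (A \<inter> B) = 0"
  defines "p \<equiv> measure F A" and "q \<equiv> measure F B"
  shows "(\<lambda>n. CLINT \<omega>|M. iexp (a * empirical_process A n \<omega> + b * empirical_process B n \<omega>))
    \<longlonglongrightarrow> complex_of_real (exp (- (a\<^sup>2 * (p * (1 - p)) + b\<^sup>2 * (q * (1 - q)) - 2 * a * b * (p * q)) / 2))"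
proof -
  define h :: "'x \<Rightarrow> real" where "h z = a * indicator A z + b * indicator B z" for z
  have h [measurable]: "h \<in> borel_measurable borel"
    unfolding h_def by measurable
  have int: "integrable M (\<lambda>\<omega>. indicator C (X i \<omega>) :: real)" if [measurable]: "C \<in> sets borel" for C i
    by (intro integrable_const_bound[of _ 1]) auto
  have E: "expectation (\<lambda>\<omega>. h (X i \<omega>)) = a * p + b * q" for i
    using int by (simp add: h_def expectation_indicator p_def q_def)
  have h2: "(h z)\<^sup>2 = a\<^sup>2 * indicator A z + b\<^sup>2 * indicator B z + 2 * a * b * indicator (A \<inter> B) z" for z
    by (auto simp: h_def power2_eq_square algebra_simps split: split_indicator)
  have int2: "integrable M (\<lambda>\<omega>. (h (X i \<omega>))\<^sup>2)" for i
    unfolding h2 using int by simp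
  have E2: "expectation (\<lambda>\<omega>. (h (X i \<omega>))\<^sup>2) = a\<^sup>2 * p + b\<^sup>2 * q" for i
    unfolding h2 using int null by (simp add: expectation_indicator p_def q_def)
  have "variance (\<lambda>\<omega>. h (X i \<omega>)) = a\<^sup>2 * p + b\<^sup>2 * q - (a * p + b * q)\<^sup>2" for i
    using int int2 E E2 by (subst variance_eq) (auto simp: h_def)
  then have var: "variance (\<lambda>\<omega>. h (X i \<omega>))
      = a\<^sup>2 * (p * (1 - p)) + b\<^sup>2 * (q * (1 - q)) - 2 * a * b * (p * q)" for i
    by (simp add: power2_eq_square algebra_simps)
  have hX: "indep_vars (\<lambda>_. borel) (\<lambda>i \<omega>. h (X i \<omega>)) UNIV"
    by (rule indep_vars_compose2[OF indep]) simp
  have dist: "distr M borel (\<lambda>\<omega>. h (X i \<omega>)) = distr F borel h" for i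
    unfolding distr_X[of i, symmetric] by (subst distr_distr) (auto simp: comp_def)
  have "a * empirical_process A n \<omega> + b * empirical_process B n \<omega>
      = 1 * ((\<Sum>i<n. h (X i \<omega>) - (a * p + b * q)) / sqrt (real n))" for n \<omega>
    by (simp add: empirical_process_eq h_def p_def q_def sum_subtractf sum.distrib sum_distrib_left[symmetric]
        diff_divide_distrib add_divide_distrib algebra_simps)
  then show ?thesis
    using central_limit_theorem_iexp[OF hX E int2 var dist, of 1] by (simp only: power_one mult_1_right)
qed

lemma weak_conv_m_empirical_process:
  assumes A [measurable]: "A \<in> sets borel"
  shows "weak_conv_m (\<lambda>n. distr M borel (empirical_process A n))
    (normal_distribution 0 (measure F A * (1 - measure F A)))"
proof (rule levy_continuity)
  interpret F: prob_space F
    unfolding distr_X[of 0, symmetric] by (rule prob_space_distr) simp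
  have v: "0 \<le> measure F A * (1 - measure F A)"
    by simp
  then show "real_distribution (normal_distribution 0 (measure F A * (1 - measure F A)))"
    by (rule real_distribution_normal_distribution)
  show "real_distribution (distr M borel (empirical_process A n))" for n
    by (rule real_distribution_distr) simp
  show "(\<lambda>n. char (distr M borel (empirical_process A n)) t)
      \<longlonglongrightarrow> char (normal_distribution 0 (measure F A * (1 - measure F A))) t" for t
    using empirical_process_iexp[OF A, of "{}" t 0]
    by (simp add: char_def[of "distr _ _ _"] integral_distr char_normal_distribution[OF v] mult.commute)
qed

text \<open>The larger set exceeds the smaller one by a fixed amount, which the scaling by
  \<open>sqrt n\<close> sends to infinity.\<close>

lemma weak_conv_m_min_empirical_unequal:
  assumes A [measurable]: "A \<in> sets borel" and B [measurable]: "B \<in> sets borel"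
    and less: "measure F A < measure F B"
  shows "weak_conv_m (\<lambda>n. distr M borel (\<lambda>\<omega>. sqrt (real n) *
      (min (measure (empirical_distribution n (\<lambda>i. X i \<omega>)) A)
           (measure (empirical_distribution n (\<lambda>i. X i \<omega>)) B) - measure F A)))
    (normal_distribution 0 (measure F A * (1 - measure F A)))"
proof -
  interpret F: prob_space F
    unfolding distr_X[of 0, symmetric] by (rule prob_space_distr) simp
  define c where "c n = sqrt (real n) * (measure F B - measure F A)" for n
  have "filterlim c at_top sequentially"
    unfolding c_def using less
    by (intro filterlim_at_top_mult_tendsto_pos[OF tendsto_const]
        filterlim_compose[OF sqrt_at_top filterlim_real_sequentially]) simp
  then have "weak_conv_m (\<lambda>n. distr M borel (\<lambda>\<omega>. min (empirical_process A n \<omega>) (empirical_process B n \<omega> + c n)))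
      (normal_distribution 0 (measure F A * (1 - measure F A)))"
    by (intro weak_conv_m_min_shifted[OF prob_space_axioms _ _ _
          weak_conv_m_empirical_process[OF A] weak_conv_m_empirical_process[OF B]]
        real_distribution_normal_distribution) auto
  moreover have "sqrt (real n) * (min s t - measure F A)
      = min (sqrt (real n) * (s - measure F A)) (sqrt (real n) * (t - measure F B) + c n)" for n s t
  proof -
    have "sqrt (real n) * (t - measure F B) + c n = sqrt (real n) * (t - measure F A)"
      by (simp add: c_def algebra_simps)
    then show ?thesis
      by (simp add: min_mult_distrib_left min_diff_distrib_left)
  qed
  ultimately show ?thesis
    by (simp add: empirical_process_def)
qed

text \<open>Both the empirical combinations in the limit and those of the given pair have
  variance \<open>(a\<^sup>2 + b\<^sup>2) p (1 - p) - 2 a b p\<^sup>2\<close>.\<close>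

lemma weak_conv_m_min_empirical_equal:
  assumes A [measurable]: "A \<in> sets borel" and B [measurable]: "B \<in> sets borel"
    and null: "measure F (A \<inter> B) = 0"
    and p: "measure F A = p" "measure F B = p"
    and pair: "centred_normal_pair P Y Z (p * (1 - p)) (- p\<^sup>2)"
  shows "weak_conv_m (\<lambda>n. distr M borel (\<lambda>\<omega>. sqrt (real n) *
      (min (measure (empirical_distribution n (\<lambda>i. X i \<omega>)) A)
           (measure (empirical_distribution n (\<lambda>i. X i \<omega>)) B) - p)))
    (distr P borel (\<lambda>\<omega>. min (Y \<omega>) (Z \<omega>)))"
proof -
  have P: "prob_space P" and [measurable]: "Y \<in> borel_measurable P" "Z \<in> borel_measurable P"
    using pair by (auto simp: centred_normal_pair_def jointly_normal_def)
  have "weak_conv_m (\<lambda>n. distr M borel (\<lambda>\<omega>. min (empirical_process A n \<omega>) (empirical_process B n \<omega>)))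
      (distr P borel (\<lambda>\<omega>. min (Y \<omega>) (Z \<omega>)))"
  proof (rule weak_conv_m_min[OF prob_space_axioms P])
    fix a b :: real
    let ?w = "(a\<^sup>2 + b\<^sup>2) * (p * (1 - p)) + 2 * a * b * (- p\<^sup>2)"
    have "(CLINT \<omega>|P. iexp (a * Y \<omega> + b * Z \<omega>)) = char (distr P borel (\<lambda>\<omega>. a * Y \<omega> + b * Z \<omega>)) 1"
      unfolding char_def by (subst integral_distr) auto
    also have "\<dots> = complex_of_real (exp (- ?w / 2))"
      unfolding centred_normal_pair_combination(2)[OF pair]
      using centred_normal_pair_combination(1)[OF pair] by (simp add: char_normal_distribution)
    also have "- ?w / 2 = - (a\<^sup>2 * (p * (1 - p)) + b\<^sup>2 * (p * (1 - p)) - 2 * a * b * (p * p)) / 2"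
      by (simp add: power2_eq_square algebra_simps)
    finally show "(\<lambda>n. CLINT \<omega>|M. iexp (a * empirical_process A n \<omega> + b * empirical_process B n \<omega>))
        \<longlonglongrightarrow> (CLINT \<omega>|P. iexp (a * Y \<omega> + b * Z \<omega>))"
      using empirical_process_iexp[OF A B null, of a b] by (simp only: p)
  qed auto
  moreover have "sqrt (real n) * (min s t - p) = min (sqrt (real n) * (s - p)) (sqrt (real n) * (t - p))" for n s t
    by (simp add: min_mult_distrib_left min_diff_distrib_left)
  ultimately show ?thesis
    by (simp add: empirical_process_def p)
qed

end

section \<open>The two parts of the cone\<close>

lemma cone_sets:
  "cone_A \<alpha> x u s \<in> sets borel" "cone_B \<alpha> x u s \<in> sets borel"
proof -
  have "closed (cone_at \<alpha> x u s)"
    by (auto simp: cone_at_def intro!: closed_Collect_le continuous_intros)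
  moreover have "closed {z. (z - x) \<bullet> u \<ge> 0}" "closed {z. (z - x) \<bullet> u \<le> 0}"
    by (auto intro!: closed_Collect_le continuous_intros)
  ultimately show "cone_A \<alpha> x u s \<in> sets borel" "cone_B \<alpha> x u s \<in> sets borel"
    by (auto simp: cone_A_def cone_B_def intro!: borel_closed closed_Int)
qed

text \<open>The two parts meet in the hyperplane through \<open>x\<close> orthogonal to \<open>u\<close>, which has
  Lebesgue measure zero.\<close>

lemma cone_overlap_null:
  fixes f :: "real^'d \<Rightarrow> ennreal"
  assumes f: "f \<in> borel_measurable lborel" and u: "u \<noteq> 0"
  shows "measure (density lborel f) (cone_A \<alpha> x u s \<inter> cone_B \<alpha> x u s) = 0"
proof -
  let ?H = "{z. u \<bullet> z = u \<bullet> x}"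
  have [measurable]: "?H \<in> sets borel"
    by (intro borel_closed closed_hyperplane)
  have "?H \<in> null_sets lebesgue"
    using negligible_hyperplane[of u "u \<bullet> x"] u by (simp add: negligible_iff_null_sets)
  then have "?H \<in> null_sets lborel"
    by (simp add: null_sets_completion_iff)
  then have "?H \<in> null_sets (density lborel f)"
    using absolutely_continuousI_density[OF f] by (auto simp: absolutely_continuous_def)
  moreover have "cone_A \<alpha> x u s \<inter> cone_B \<alpha> x u s \<subseteq> ?H"
    by (auto simp: cone_A_def cone_B_def inner_diff_left inner_diff_right inner_commute split: if_splits)
  moreover have "cone_A \<alpha> x u s \<inter> cone_B \<alpha> x u s \<in> sets (density lborel f)"
    by (simp add: sets.Int cone_sets)
  ultimately have "cone_A \<alpha> x u s \<inter> cone_B \<alpha> x u s \<in> null_sets (density lborel f)"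
    using null_sets_subset by blast
  then show ?thesis
    by (simp add: measure_eq_0_null_sets)
qed

theorem corollary8p1:
  fixes \<alpha> :: real
    and F :: "(real^'d) measure"
    and f :: "real^'d \<Rightarrow> ennreal"
    and M :: "'w measure"
    and X :: "nat \<Rightarrow> 'w \<Rightarrow> real^'d"
    and x u :: "real^'d"
    and s :: real
  assumes "0 \<le> \<alpha>" and "\<alpha> < pi"
    and "CARD('d) \<ge> 2"
    and "prob_space F"
    and "f \<in> borel_measurable lborel" and "F = density lborel f"
    and "prob_space M"
    and "prob_space.indep_vars M (\<lambda>_. borel) X UNIV"
    and "\<And>i. distr M borel (X i) = F"
    and "u \<in> sphere 0 1"
  defines "d \<equiv> cone_d \<alpha> F x u s"
    and "\<sigma>2 \<equiv> cone_sigma2 \<alpha> F x u s"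
    and "T \<equiv> \<lambda>n. distr M borel (\<lambda>\<omega>.
           sqrt (real n) *
             (cone_d \<alpha> (empirical_distribution n (\<lambda>i. X i \<omega>)) x u s - cone_d \<alpha> F x u s))"
  shows "(cone_Delta \<alpha> F x u s \<noteq> 0 \<longrightarrow> weak_conv_m T (normal_distribution 0 \<sigma>2)) \<and>
         (cone_Delta \<alpha> F x u s = 0 \<longrightarrow>
            (\<exists>(P :: (real \<times> real) measure) N1 N2. centred_normal_pair P N1 N2 \<sigma>2 (- d\<^sup>2)) \<and>
            (\<forall>(P :: 'p measure) N1 N2. centred_normal_pair P N1 N2 \<sigma>2 (- d\<^sup>2) \<longrightarrow>
               weak_conv_m T (distr P borel (\<lambda>\<omega>. min (N1 \<omega>) (N2 \<omega>)))))"
proof -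
  interpret M: prob_space M by fact
  interpret F: prob_space F by fact
  interpret iid_sample M X F
    by unfold_locales fact+
  let ?A = "cone_A \<alpha> x u s" and ?B = "cone_B \<alpha> x u s"
  define p q where "p = measure F ?A" and "q = measure F ?B"
  have d: "d = min p q" and \<sigma>2: "\<sigma>2 = d * (1 - d)"
    by (simp_all add: d_def \<sigma>2_def cone_d_def cone_sigma2_def p_def q_def)
  have Delta: "cone_Delta \<alpha> F x u s = \<bar>p - q\<bar>"
    by (simp add: cone_Delta_def p_def q_def)
  have T: "T = (\<lambda>n. distr M borel (\<lambda>\<omega>. sqrt (real n) *
      (min (measure (empirical_distribution n (\<lambda>i. X i \<omega>)) ?A)
           (measure (empirical_distribution n (\<lambda>i. X i \<omega>)) ?B) - d)))"
    by (simp add: T_def d_def cone_d_def)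
  have "u \<noteq> 0"
    using \<open>u \<in> sphere 0 1\<close> by auto
  then have null: "measure F (?A \<inter> ?B) = 0"
    using cone_overlap_null[OF \<open>f \<in> borel_measurable lborel\<close>] \<open>F = density lborel f\<close> by simp
  show ?thesis
  proof (intro conjI impI)
    assume "cone_Delta \<alpha> F x u s \<noteq> 0"
    then consider "p < q" | "q < p"
      using Delta by linarith
    then show "weak_conv_m T (normal_distribution 0 \<sigma>2)"
    proof cases
      case 1
      then show ?thesis
        using weak_conv_m_min_empirical_unequal[OF cone_sets[of \<alpha> x u s]]
        by (simp add: T \<sigma>2 d p_def q_def)
    next
      case 2
      then show ?thesis
        using weak_conv_m_min_empirical_unequal[OF cone_sets(2,1)[of \<alpha> x u s]]
        by (simp add: T \<sigma>2 d p_def q_def min.commute)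
    qed
  next
    assume "cone_Delta \<alpha> F x u s = 0"
    then have "p = q"
      using Delta by simp
    then have pq: "measure F ?A = d" "measure F ?B = d"
      by (simp_all add: d p_def q_def)
    have sets_F: "sets F = sets borel"
      using \<open>F = density lborel f\<close> by simp
    have "d + d = measure F (?A \<union> ?B)"
      using cone_sets null pq by (subst measure_Un3) (auto simp: F.fmeasurable_eq_sets sets_F)
    \<comment> \<open>This bound makes \<open>\<sigma>2 - d\<^sup>2 = d (1 - 2 d)\<close> nonnegative, so that the covariance matrix
      of the limiting pair is positive semidefinite.\<close>
    then have "2 * d \<le> 1"
      using F.prob_le_1[of "?A \<union> ?B"] by simp
    moreover have "0 \<le> d"
      using pq(1)[symmetric] by simp
    ultimately have "0 \<le> \<sigma>2 + - d\<^sup>2" "0 \<le> \<sigma>2 - - d\<^sup>2"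
      using mult_nonneg_nonneg[of d "1 - 2 * d"] by (simp_all add: \<sigma>2 power2_eq_square algebra_simps)
    then show "\<exists>(P :: (real \<times> real) measure) N1 N2. centred_normal_pair P N1 N2 \<sigma>2 (- d\<^sup>2)"
      by (rule centred_normal_pair_exists)
    show "\<forall>(P :: 'p measure) N1 N2. centred_normal_pair P N1 N2 \<sigma>2 (- d\<^sup>2) \<longrightarrow>
        weak_conv_m T (distr P borel (\<lambda>\<omega>. min (N1 \<omega>) (N2 \<omega>)))"
      unfolding T \<sigma>2
      using weak_conv_m_min_empirical_equal[OF cone_sets[of \<alpha> x u s] null pq] by blast
  qed
qed

end
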